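(* Let $\mu_1,\dots,\mu_r>-1$ be such that $\mu_i-\mu_j\notin\mathbb Z$ if $i\neq j$. Let $\vec n=(n_1,\dots,n_r),\ \vec j=(j_1,\dots,j_r)\in\mathbb N_0^r$ be such that $0\le|\vec j|\le|\vec n|/2$, and let $\nu\in\{1,2\}$ (with $|\vec j|<|\vec n|/2$ if $\nu=2$). Then for $a,b\in\mathbb N_0$, $$\int_D\sum_{l=1}^r\mathbf A^{\vec n}_{\vec j,\nu,(l)}(x,y)\,x^ay^b\,W_l(x,y)\,dx\,dy=0\qquad\text{if }0\le a+b<|\vec n|-2.$$ Moreover, $$\int_D\sum_{l=1}^r\mathbf A^{\vec n}_{\vec j,\nu,(l)}(x,y)\,x^ay^b\,W_l(x,y)\,dx\,dy=0\qquad\text{if }a+b-|\vec n|+2|\vec j|\text{ is odd}.$$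
   Context: For a multi-index $\vec v=(v_1,\dots,v_r)\in\mathbb N_0^r$, $|\vec v|=v_1+\cdots+v_r$. $D=\{(x,y)\in\mathbb R^2:x^2+y^2\le1\}$ is the unit disk, with polar coordinates $x=\rho\cos\theta$, $y=\rho\sin\theta$. Write $\vec\mu=(\mu_1,\dots,\mu_r)$, and $W_l(x,y)=w_{\mu_l}(1-x^2-y^2)^{\mu_l}$ with $w_\mu=(\mu+1)/\pi$. Type I Jacobi–Piñeiro polynomials: for $M\in\mathbb N_0$ and $\vec k\in\mathbb N_0^r$, $(A^{(M,\vec\mu)}_{\vec k,1},\dots,A^{(M,\vec\mu)}_{\vec k,r})$ is the unique vector of univariate polynomials with $\deg A^{(M,\vec\mu)}_{\vec k,l}\le k_l-1$ (so the $l$-th one is $0$ if $k_l=0$) and $$\sum_{l=1}^r w_{\mu_l}\int_0^1A^{(M,\vec\mu)}_{\vec k,l}(t)\,t^s\,t^{M}(1-t)^{\mu_l}\,dt=\delta_{s,|\vec k|-1},\qquad 0\le s\le|\vec k|-1 .$$ Type I multiple orthogonal polynomials on the disk: with $M=|\vec n|-2|\vec j|$ and $1\le l\le r$, $$\mathbf A^{\vec n}_{\vec j,1,(l)}(\rho,\theta)=A^{(M,\vec\mu)}_{\vec j,l}(\rho^2)\,\rho^{M}\cos(M\theta)\quad(0\le|\vec j|\le|\vec n|/2),$$ $$\mathbf A^{\vec n}_{\vec j,2,(l)}(\rho,\theta)=A^{(M,\vec\mu)}_{\vec j,l}(\rho^2)\,\rho^{M}\sin(M\theta)\quad(0\le|\vec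 j|<|\vec n|/2).$$ These are polynomials in $(x,y)$. *)

theory Defs
  imports "HOL-Analysis.Analysis" "HOL-Computational_Algebra.Polynomial"
begin

definition multi_abs :: "('r::finite \<Rightarrow> nat) \<Rightarrow> nat" where
  "multi_abs v = (\<Sum>l\<in>UNIV. v l)"

definition unit_disk :: "(real \<times> real) set" where
  "unit_disk = {(x, y). x\<^sup>2 + y\<^sup>2 \<le> 1}"

definition weight_const :: "real \<Rightarrow> real" where
  "weight_const \<mu> = (\<mu> + 1) / pi"

definition disk_weight :: "real \<Rightarrow> real \<Rightarrow> real \<Rightarrow> real" where
  "disk_weight \<mu> x y = weight_const \<mu> * (1 - x\<^sup>2 - y\<^sup>2) powr \<mu>"

text \<open>
  The disjunction in the degree condition is the convention \<open>deg (A l) \<le> k l - 1\<close>, which means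
  \<open>A l = 0\<close> when \<open>k l = 0\<close>. The indices \<open>0 \<le> s \<le> |k| - 1\<close> are written \<open>s < |k|\<close>, so that there is
  no condition when \<open>|k| = 0\<close>.
\<close>
definition is_type_I_Jacobi_Pineiro ::
    "nat \<Rightarrow> ('r::finite \<Rightarrow> real) \<Rightarrow> ('r \<Rightarrow> nat) \<Rightarrow> ('r \<Rightarrow> real poly) \<Rightarrow> bool" where
  "is_type_I_Jacobi_Pineiro M \<mu> k A \<longleftrightarrow>
     (\<forall>l. A l = 0 \<or> degree (A l) < k l) \<and>
     (\<forall>s < multi_abs k.
        (\<Sum>l\<in>UNIV. weight_const (\<mu> l) *
           (LBINT t:{0..1}. poly (A l) t * t ^ s * (t ^ M * (1 - t) powr \<mu> l)))
        = (if s + 1 = multi_abs k then 1 else 0))"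

definition type_I_Jacobi_Pineiro ::
    "nat \<Rightarrow> ('r::finite \<Rightarrow> real) \<Rightarrow> ('r \<Rightarrow> nat) \<Rightarrow> 'r \<Rightarrow> real poly" where
  "type_I_Jacobi_Pineiro M \<mu> k = (THE A. is_type_I_Jacobi_Pineiro M \<mu> k A)"

text \<open>
  The polynomials below are meant for \<open>2 * |j| \<le> |n|\<close> (so the subtraction defining \<open>M\<close> does not
  truncate) and \<open>\<nu> \<in> {1, 2}\<close>.
\<close>
definition type_I_disk_polar ::
    "('r::finite \<Rightarrow> real) \<Rightarrow> ('r \<Rightarrow> nat) \<Rightarrow> ('r \<Rightarrow> nat) \<Rightarrow> nat \<Rightarrow> 'r \<Rightarrow> real \<Rightarrow> real \<Rightarrow> real" where
  "type_I_disk_polar \<mu> n j \<nu> l \<rho> \<theta> =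
     (let M = multi_abs n - 2 * multi_abs j
      in poly (type_I_Jacobi_Pineiro M \<mu> j l) (\<rho>\<^sup>2) * \<rho> ^ M *
         (if \<nu> = 1 then cos (real M * \<theta>) else sin (real M * \<theta>)))"

definition type_I_disk ::
    "('r::finite \<Rightarrow> real) \<Rightarrow> ('r \<Rightarrow> nat) \<Rightarrow> ('r \<Rightarrow> nat) \<Rightarrow> nat \<Rightarrow> 'r \<Rightarrow> real \<Rightarrow> real \<Rightarrow> real" where
  "type_I_disk \<mu> n j \<nu> l x y =
     type_I_disk_polar \<mu> n j \<nu> l (sqrt (x\<^sup>2 + y\<^sup>2)) (Arg (Complex x y))"

text \<open>The choice of angle in \<open>type_I_disk\<close> is immaterial, also at the origin.\<close>
lemma type_I_disk_polar_coords:
  assumes "\<rho> \<ge> 0"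
  shows "type_I_disk \<mu> n j \<nu> l (\<rho> * cos \<theta>) (\<rho> * sin \<theta>) = type_I_disk_polar \<mu> n j \<nu> l \<rho> \<theta>"
proof -
  define M where "M = multi_abs n - 2 * multi_abs j"
  define z where "z = Complex (\<rho> * cos \<theta>) (\<rho> * sin \<theta>)"
  have z: "z = of_real \<rho> * cis \<theta>"
    by (simp add: z_def complex_eq_iff)
  have norm_z: "cmod z = \<rho>"
    using assms by (simp add: z norm_mult)
  have sqrt_z: "sqrt ((\<rho> * cos \<theta>)\<^sup>2 + (\<rho> * sin \<theta>)\<^sup>2) = \<rho>"
    using norm_z by (simp add: z_def complex_norm)
  have "z = of_real \<rho> * cis (Arg z)"
    using norm_z rcis_cmod_Arg[of z] by (simp add: rcis_def)
  then have "of_real (\<rho> ^ M) * cis (real M * Arg z) = of_real (\<rho> ^ M) * cis (real M * \<theta>)"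
    using z by (metis Complex.DeMoivre of_real_power power_mult_distrib)
  then have "\<rho> ^ M * cos (real M * Arg z) = \<rho> ^ M * cos (real M * \<theta>)"
    and "\<rho> ^ M * sin (real M * Arg z) = \<rho> ^ M * sin (real M * \<theta>)"
    by (simp_all add: complex_eq_iff del: of_real_power)
  then show ?thesis
    by (simp add: type_I_disk_def type_I_disk_polar_def sqrt_z Let_def mult.assoc
        flip: M_def z_def)
qed

end

theory Submission
  imports Defs
begin

text \<open>
  Write \<open>z = x + \<i> y\<close>. Up to taking real or imaginary parts, the integrand is
  \<open>g (\<bar>z\<bar>\<^sup>2) z ^ M x ^ a y ^ b\<close> with \<open>g t = (\<Sum>l. A l t * w l (1 - t) powr \<mu> l)\<close>. Expanding
  \<open>x ^ a y ^ b\<close> into the monomials \<open>z ^ p (cnj z) ^ q\<close> with \<open>p + q = a + b\<close>, invariance under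
  rotations kills all terms except the one with \<open>M + p = q\<close>, i.e. \<open>a + b = M + 2 p\<close>, and this one is
  \<open>\<pi>\<close> times the \<open>p\<close>-th moment of the type I Jacobi-Pineiro system. The moment vanishes for
  \<open>p + 1 < \<bar>j\<bar>\<close>, that is, for \<open>a + b < \<bar>n\<bar> - 2\<close>; if \<open>a + b - M\<close> is odd, no term survives.

  Existence and uniqueness of the Jacobi-Pineiro polynomials are an interpolation problem: in the
  basis of powers of \<open>1 - t\<close>, the moments are Beta integrals, which are rational functions of the
  exponents \<open>\<mu> l + i\<close>, and these exponents are pairwise distinct.
\<close>

subsection \<open>Type I Jacobi-Pineiro polynomials\<close>

text \<open>Euler's Beta integral at (m + 1, \<alpha> + 1). As m is a natural number, the quotient
  of Gamma values collapses to a finite product, which makes the moment a rational function of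
  \<alpha>.\<close>

lemma
  fixes \<alpha> :: real
  assumes "\<alpha> > -1"
  shows set_integrable_power_times_powr:
      "set_integrable lborel {0..1} (\<lambda>t. t ^ m * (1 - t) powr \<alpha>)"
    and set_integral_power_times_powr:
      "(LBINT t:{0..1}. t ^ m * (1 - t) powr \<alpha>) = fact m / pochhammer (\<alpha> + 1) (Suc m)"
proof -
  let ?f = "\<lambda>t. t ^ m * (1 - t) powr \<alpha>"
  let ?g = "\<lambda>t. t powr (real (Suc m) - 1) * (1 - t) powr ((\<alpha> + 1) - 1)"
  have "?g t = ?f t" if "t \<noteq> 0" "t \<in> {0..1}" for t
  proof -
    have "t powr (real (Suc m) - 1) = t powr real m" by simp
    also have "\<dots> = t ^ m" using that by (intro powr_realpow) auto
    finally show ?thesis by simp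
  qed
  \<comment> \<open>\<open>0 powr 0\<close> is 0 but \<open>0 ^ 0\<close> is 1, so for
    \<open>m = 0\<close> the integrands differ at \<open>t = 0\<close>.\<close>
  then have "AE t in lborel. t \<in> {0..1} \<longrightarrow> ?g t = ?f t"
    using AE_lborel_singleton[of "0::real"] by auto
  then have ae: "AE t in lborel. indicator {0..1} t *\<^sub>R ?g t = indicator {0..1} t *\<^sub>R ?f t"
    by eventually_elim (simp add: indicator_def)
  have m: "(\<lambda>t. indicator {0..1} t *\<^sub>R ?g t) \<in> borel_measurable lborel"
      "(\<lambda>t. indicator {0..1} t *\<^sub>R ?f t) \<in> borel_measurable lborel"
    by simp_all
  have int: "set_integrable lborel {0..1} ?g"
    using assms by (intro integrable_Beta) auto
  then show "set_integrable lborel {0..1} ?f"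
    unfolding set_integrable_def using integrable_cong_AE[OF m ae] by blast
  have "(LBINT t:{0..1}. ?f t) = (LBINT t:{0..1}. ?g t)"
    unfolding set_lebesgue_integral_def using integral_cong_AE[OF m ae] by (rule sym)
  also have "\<dots> = Beta (real (Suc m)) (\<alpha> + 1)"
    using has_integral_Beta_real[of "real (Suc m)" "\<alpha> + 1"] assms
    by (subst set_borel_integral_eq_integral(2)[OF int]) (auto intro: integral_unique)
  also have "\<dots> = fact m / pochhammer (\<alpha> + 1) (Suc m)"
  proof -
    have "\<alpha> + 1 \<notin> \<int>\<^sub>\<le>\<^sub>0" using assms nonpos_Ints_nonpos[of "\<alpha> + 1"] by force
    then have "pochhammer (\<alpha> + 1) (Suc m) = Gamma (\<alpha> + 1 + real (Suc m)) / Gamma (\<alpha> + 1)"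
      by (rule pochhammer_Gamma)
    moreover have "Gamma (real (Suc m)) = fact m"
      using Gamma_fact[of m, where ?'a = real] by (simp add: add.commute)
    ultimately show ?thesis by (simp add: Beta_def add_ac)
  qed
  finally show "(LBINT t:{0..1}. t ^ m * (1 - t) powr \<alpha>) = fact m / pochhammer (\<alpha> + 1) (Suc m)" .
qed

section \<open>Univariate interpolation\<close>

text \<open>Polynomials of exact degrees 0, ..., N - 1 span all polynomials of degree below N, so a
  linear functional that kills each of them kills the span. The induction cancels the top
  coefficient with a multiple of \<open>q m\<close>.\<close>

lemma sum_poly_eq_zero_if_zero_on_staircase:
  fixes e :: "'i \<Rightarrow> 'a::field" and q :: "nat \<Rightarrow> 'a poly"
  assumes q: "\<And>d. d < N \<Longrightarrow> q d \<noteq> 0 \<and> degree (q d) = d"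
    and zero: "\<And>d. d < N \<Longrightarrow> (\<Sum>i\<in>I. e i * poly (q d) (\<alpha> i)) = 0"
    and "degree p < N"
  shows "(\<Sum>i\<in>I. e i * poly p (\<alpha> i)) = 0"
proof -
  have "(\<Sum>i\<in>I. e i * poly p (\<alpha> i)) = 0" if "m \<le> N" "\<And>k. k \<ge> m \<Longrightarrow> coeff p k = 0" for m p
    using that
  proof (induction m arbitrary: p)
    case 0
    then have "p = 0" by (simp add: poly_eq_iff)
    then show ?case by simp
  next
    case (Suc m)
    define c where "c = coeff p m / coeff (q m) m"
    have qm: "coeff (q m) m \<noteq> 0" "degree (q m) = m"
      using q[of m] Suc.prems(1) leading_coeff_0_iff[of "q m"] by (metis Suc_le_lessD)+
    have "(\<Sum>i\<in>I. e i * poly (p - smult c (q m)) (\<alpha> i)) = 0"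
    proof (rule Suc.IH)
      fix k assume "k \<ge> m"
      then show "coeff (p - smult c (q m)) k = 0"
        using qm Suc.prems(2)[of k] by (cases "k = m") (auto simp: c_def coeff_eq_0)
    qed (use Suc.prems in simp)
    moreover have "(\<Sum>i\<in>I. e i * poly (p - smult c (q m)) (\<alpha> i))
        = (\<Sum>i\<in>I. e i * poly p (\<alpha> i)) - c * (\<Sum>i\<in>I. e i * poly (q m) (\<alpha> i))"
      by (simp add: algebra_simps sum_subtractf sum_distrib_left)
    ultimately show ?case using zero[of m] Suc.prems by simp
  qed
  from this[of N p] show ?thesis using assms(3) by (auto simp: coeff_eq_0)
qed

text \<open>Both sides, as polynomials in \<open>x\<close>, have degree below \<open>card I\<close>
  and agree at the \<open>card I\<close> distinct nodes, hence coincide.\<close>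

lemma Lagrange_interpolation:
  fixes \<alpha> :: "'i \<Rightarrow> 'a::field"
  assumes "finite I" "inj_on \<alpha> I" "degree p < card I"
  shows "(\<Sum>i\<in>I. (\<Prod>k\<in>I - {i}. (x - \<alpha> k) / (\<alpha> i - \<alpha> k)) * poly p (\<alpha> i)) = poly p x"
proof -
  define b where "b i = (\<Prod>k\<in>I - {i}. smult (1 / (\<alpha> i - \<alpha> k)) [:- \<alpha> k, 1:])" for i
  define l where "l = (\<Sum>i\<in>I. smult (poly p (\<alpha> i)) (b i))"
  have b: "poly (b i) y = (\<Prod>k\<in>I - {i}. (y - \<alpha> k) / (\<alpha> i - \<alpha> k))" for i y
    unfolding b_def poly_prod by (intro prod.cong refl) (simp add: diff_divide_distrib)
  have "degree (b i) < card I" if "i \<in> I" for i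
  proof -
    have "degree (b i) \<le> (\<Sum>k\<in>I - {i}. (degree \<circ> (\<lambda>k. smult (1 / (\<alpha> i - \<alpha> k)) [:- \<alpha> k, 1:])) k)"
      unfolding b_def by (rule degree_prod_sum_le) (use assms(1) in simp)
    also have "\<dots> \<le> (\<Sum>k\<in>I - {i}. 1)"
      by (intro sum_mono) (simp add: degree_smult_le[THEN order_trans])
    also have "\<dots> < card I"
      using card_Diff1_less[OF assms(1) that] by simp
    finally show ?thesis .
  qed
  then have "degree l < card I"
    unfolding l_def using assms by (intro degree_sum_less) (auto intro: le_less_trans[OF degree_smult_le])
  moreover have "poly l (\<alpha> i) = poly p (\<alpha> i)" if "i \<in> I" for i
  proof -
    have "poly (b k) (\<alpha> i) = (if k = i then 1 else 0)" if "k \<in> I" for k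
    proof (cases "k = i")
      case True
      have "(\<Prod>k\<in>I - {i}. (\<alpha> i - \<alpha> k) / (\<alpha> i - \<alpha> k)) = 1"
        using assms(2) \<open>i \<in> I\<close> by (intro prod.neutral) (auto simp: inj_on_def)
      then show ?thesis using True by (simp add: b)
    next
      case False
      then have "(\<Prod>j\<in>I - {k}. (\<alpha> i - \<alpha> j) / (\<alpha> k - \<alpha> j)) = 0"
        using assms(1) \<open>i \<in> I\<close> by (intro prod_zero) auto
      then show ?thesis using False by (simp add: b)
    qed
    then have "poly l (\<alpha> i) = (\<Sum>k\<in>I. if k = i then poly p (\<alpha> k) else 0)"
      unfolding l_def poly_sum by (intro sum.cong refl) simp
    then show ?thesis using assms(1) that by simp
  qed
  ultimately have "l = p"
    using assms by (intro poly_eqI_degree[of "\<alpha> ` I"]) (auto simp: card_image)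
  then have "poly p x = poly l x" by simp
  also have "\<dots> = (\<Sum>i\<in>I. (\<Prod>k\<in>I - {i}. (x - \<alpha> k) / (\<alpha> i - \<alpha> k)) * poly p (\<alpha> i))"
    by (simp add: l_def poly_sum b mult.commute)
  finally show ?thesis by simp
qed

section \<open>The linear system of Beta moments\<close>

lemma poly_pochhammer: "poly (pochhammer p n) x = pochhammer (poly p x) n"
  by (simp add: pochhammer_prod poly_prod)

lemma degree_pochhammer_linear: "degree (pochhammer [:c, 1::'a::idom:] n) = n"
proof -
  have "[:c, 1:] + of_nat i = [:c + of_nat i, 1:]" for i
    by (simp add: of_nat_poly)
  then show ?thesis
    unfolding pochhammer_prod by (subst degree_prod_sum_eq) auto
qed

text \<open>Closed form of the integral of t^(s + M) (1 - t)^\<alpha> over the unit interval for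
  \<alpha> > -1.\<close>

definition JP_moment :: "nat \<Rightarrow> nat \<Rightarrow> real \<Rightarrow> real" where
  "JP_moment M s \<alpha> = fact (s + M) / pochhammer (\<alpha> + 1) (Suc (s + M))"

text \<open>The pochhammer product of length \<open>N + M\<close> is a common multiple of the
  denominators of all moments with \<open>s < N\<close>. Cancelling leaves its last
  \<open>N - 1 - s\<close> factors, from \<alpha> + s + M + 2 up to \<alpha> + N + M.\<close>

lemma JP_moment_eq_poly:
  assumes "\<alpha> > -1" "s < N"
  shows "pochhammer (\<alpha> + 1) (N + M) * JP_moment M s \<alpha>
    = fact (s + M) * poly (pochhammer [:real (s + M + 2), 1:] (N - 1 - s)) \<alpha>"
proof -
  have "pochhammer (\<alpha> + 1) (N + M)
      = pochhammer (\<alpha> + 1) (Suc (s + M)) * pochhammer (\<alpha> + 1 + real (Suc (s + M))) (N - 1 - s)"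
    using pochhammer_product[of "Suc (s + M)" "N + M" "\<alpha> + 1"] assms by (simp add: algebra_simps)
  moreover have "pochhammer (\<alpha> + 1) (Suc (s + M)) \<noteq> 0"
    using pochhammer_pos[of "\<alpha> + 1" "Suc (s + M)"] assms by simp
  ultimately show ?thesis
    by (simp add: JP_moment_def poly_pochhammer add_ac)
qed

text \<open>
  Multiplied by \<open>pochhammer (\<alpha> + 1) (N + M)\<close>, the moments become polynomials in \<open>\<alpha>\<close> of degrees
  \<open>0, \<dots>, N - 1\<close>. All except the constant one vanish at \<open>\<alpha> = - (N + M)\<close>, so the system asks for
  weights on the nodes that represent evaluation at this point.
\<close>
lemma JP_moment_system_solvable:
  fixes \<alpha> :: "'i \<Rightarrow> real"
  assumes fin: "finite I" and inj: "inj_on \<alpha> I" and pos: "\<And>i. i \<in> I \<Longrightarrow> \<alpha> i > -1"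
  shows "\<exists>c. \<forall>s<card I. (\<Sum>i\<in>I. c i * JP_moment M s (\<alpha> i)) = (if s + 1 = card I then 1 else 0)"
proof -
  define N where "N = card I"
  define q where "q s = pochhammer [:real (s + M + 2), 1:] (N - 1 - s)" for s
  define x where "x = - real (N + M)"
  \<comment> \<open>Lagrange weights for evaluation at \<open>x\<close>. The factorial is the
    prefactor of the moment \<open>s = N - 1\<close>, divided out so that its value becomes 1;
    \<open>c\<close> then supplies the common denominators.\<close>
  define e where "e i = (\<Prod>k\<in>I - {i}. (x - \<alpha> k) / (\<alpha> i - \<alpha> k)) / fact (N - 1 + M)" for i
  define c where "c i = e i * pochhammer (\<alpha> i + 1) (N + M)" for i
  have qx: "poly (q s) x = (if s + 1 = N then 1 else 0)" if "s < N" for s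
  proof (cases "s + 1 = N")
    case True
    then show ?thesis by (simp add: q_def)
  next
    case False
    \<comment> \<open>The pochhammer product starts at a nonpositive integer and is one factor
      longer than its absolute value, so it runs into 0.\<close>
    then have "x + real (s + M + 2) = - real (N - s - 2)"
      using that by (simp add: x_def of_nat_diff)
    then have "poly (q s) x = pochhammer (- real (N - s - 2)) (N - 1 - s)"
      by (simp add: q_def poly_pochhammer add.commute)
    also have "\<dots> = 0" using that False by (subst pochhammer_of_nat_eq_0_iff) linarith
    finally show ?thesis using False by simp
  qed
  have "(\<Sum>i\<in>I. c i * JP_moment M s (\<alpha> i)) = (if s + 1 = N then 1 else 0)" if "s < N" for s
  proof -
    have "(\<Sum>i\<in>I. c i * JP_moment M s (\<alpha> i)) = (\<Sum>i\<in>I. e i * (fact (s + M) * poly (q s) (\<alpha> i)))"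
      using JP_moment_eq_poly[OF pos that] by (intro sum.cong) (simp_all add: c_def q_def mult.assoc)
    also have "\<dots> = fact (s + M) / fact (N - 1 + M) *
        (\<Sum>i\<in>I. (\<Prod>k\<in>I - {i}. (x - \<alpha> k) / (\<alpha> i - \<alpha> k)) * poly (q s) (\<alpha> i))"
      by (simp add: e_def sum_distrib_left mult_ac)
    also have "\<dots> = fact (s + M) / fact (N - 1 + M) * poly (q s) x"
      using that by (subst Lagrange_interpolation[OF fin inj])
        (auto simp: N_def q_def degree_pochhammer_linear)
    also have "\<dots> = (if s + 1 = N then 1 else 0)"
      using qx[OF that] by auto
    finally show ?thesis .
  qed
  then show ?thesis unfolding N_def by blast
qed

text \<open>With the common denominators moved into the weights, the hypothesis says that
  \<open>e\<close> annihilates one polynomial of each degree below N, hence all polynomials of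
  degree below N. Testing with the product of the linear factors at all nodes but \<open>i\<close>
  isolates the weight at \<open>i\<close>.\<close>

lemma JP_moment_system_injective:
  fixes \<alpha> :: "'i \<Rightarrow> real"
  assumes fin: "finite I" and inj: "inj_on \<alpha> I" and pos: "\<And>i. i \<in> I \<Longrightarrow> \<alpha> i > -1"
    and zero: "\<And>s. s < card I \<Longrightarrow> (\<Sum>i\<in>I. c i * JP_moment M s (\<alpha> i)) = 0"
    and i: "i \<in> I"
  shows "c i = 0"
proof -
  define N where "N = card I"
  \<comment> \<open>Indexed by degree: \<open>q d\<close> belongs to the moment
    \<open>s = N - 1 - d\<close>.\<close>
  define q where "q d = pochhammer [:real (N - 1 - d + M + 2), 1:] d" for d
  define e where "e i = c i / pochhammer (\<alpha> i + 1) (N + M)" for i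
  have ph: "pochhammer (\<alpha> i + 1) (N + M) \<noteq> 0" if "i \<in> I" for i
    using pochhammer_pos[of "\<alpha> i + 1" "N + M"] pos[OF that] by simp
  define p where "p = (\<Prod>k\<in>I - {i}. [:- \<alpha> k, 1:])"
  have N: "N > 0" using fin i by (auto simp: N_def card_gt_0_iff)
  have "(\<Sum>j\<in>I. e j * poly p (\<alpha> j)) = 0"
  proof (rule sum_poly_eq_zero_if_zero_on_staircase[where N = N and q = q])
    show "degree p < N"
      unfolding p_def using fin i N by (subst degree_prod_sum_eq) (auto simp: N_def)
    fix d assume d: "d < N"
    show "q d \<noteq> 0 \<and> degree (q d) = d"
      by (cases "d = 0") (auto simp: q_def degree_pochhammer_linear dest: arg_cong[of _ _ degree])
    define s where "s = N - 1 - d"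
    have s: "s < N" "N - 1 - s = d" using d by (auto simp: s_def)
    have "fact (s + M) * (\<Sum>j\<in>I. e j * poly (q d) (\<alpha> j)) = (\<Sum>j\<in>I. c j * JP_moment M s (\<alpha> j))"
      unfolding sum_distrib_left
    proof (intro sum.cong refl)
      fix j assume j: "j \<in> I"
      have "fact (s + M) * (e j * poly (q d) (\<alpha> j)) = e j * (fact (s + M) * poly (q d) (\<alpha> j))"
        by simp
      also have "\<dots> = e j * (pochhammer (\<alpha> j + 1) (N + M) * JP_moment M s (\<alpha> j))"
        using JP_moment_eq_poly[OF pos[OF j] s(1), of M] s(2) by (simp add: q_def s_def)
      also have "\<dots> = c j * JP_moment M s (\<alpha> j)"
        using ph[OF j] by (simp add: e_def)
      finally show "fact (s + M) * (e j * poly (q d) (\<alpha> j)) = c j * JP_moment M s (\<alpha> j)" .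
    qed
    then show "(\<Sum>j\<in>I. e j * poly (q d) (\<alpha> j)) = 0"
      using zero[of s] s(1) by (simp add: N_def)
  qed
  moreover have "(\<Sum>j\<in>I. e j * poly p (\<alpha> j)) = e i * poly p (\<alpha> i)"
  proof -
    have "poly p (\<alpha> j) = 0" if "j \<in> I - {i}" for j
      using that fin by (auto simp: p_def poly_prod)
    then have "(\<Sum>j\<in>I - {i}. e j * poly p (\<alpha> j)) = 0" by simp
    then show ?thesis using fin i by (simp add: sum.remove)
  qed
  moreover have "poly p (\<alpha> i) \<noteq> 0"
    using inj i fin by (auto simp: p_def poly_prod inj_on_def)
  ultimately show ?thesis using ph[OF i] by (simp add: e_def)
qed

section \<open>Existence and uniqueness of the Jacobi-Pineiro polynomials\<close>

text \<open>When \<open>A\<close> is expanded in powers of \<open>1 - t\<close>, each factor (1 -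
  t)^i is absorbed by the weight and merely shifts its exponent to
  \<open>\<mu> + real i\<close>.\<close>

lemma
  fixes A :: "real poly"
  assumes "\<mu> > -1"
  shows set_integrable_poly_times_powr:
      "set_integrable lborel {0..1} (\<lambda>t. poly A t * t ^ s * (t ^ M * (1 - t) powr \<mu>))"
    and set_integral_poly_eq_JP_moments:
      "A = 0 \<or> degree A < k \<Longrightarrow> (LBINT t:{0..1}. poly A t * t ^ s * (t ^ M * (1 - t) powr \<mu>))
        = (\<Sum>i<k. coeff (pcompose A [:1, -1:]) i * JP_moment M s (\<mu> + real i))"
proof -
  define B where "B = pcompose A [:1, -1:]"
  have A: "poly A t = (\<Sum>i<k. coeff B i * (1 - t) ^ i)" if "A = 0 \<or> degree A < k" for t k
  proof -
    have "poly A t = poly B (1 - t)" by (simp add: B_def poly_pcompose)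
    also have "\<dots> = (\<Sum>i\<le>degree B. coeff B i * (1 - t) ^ i)" by (rule poly_altdef)
    also have "\<dots> = (\<Sum>i<k. coeff B i * (1 - t) ^ i)"
    proof (cases "A = 0")
      case False
      then show ?thesis
        using that by (intro sum.mono_neutral_left) (auto simp: B_def degree_pcompose coeff_eq_0)
    qed (simp add: B_def)
    finally show ?thesis .
  qed
  have eq: "poly A t * t ^ s * (t ^ M * (1 - t) powr \<mu>)
      = (\<Sum>i<k. coeff B i * (t ^ (s + M) * (1 - t) powr (\<mu> + real i)))"
    if "A = 0 \<or> degree A < k" "t \<in> {0..1}" for t k
  proof -
    \<comment> \<open>At \<open>t = 1\<close> both sides are 0, since 0 to any \<open>powr\<close>
      is 0.\<close>
    have "(1 - t) ^ i * (1 - t) powr \<mu> = (1 - t) powr (\<mu> + real i)" for i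
      using that(2) by (cases "t = 1") (auto simp: powr_add powr_realpow)
    then show ?thesis
      by (simp add: A[OF that(1)] sum_distrib_left sum_distrib_right power_add mult_ac)
  qed
  have int: "set_integrable lborel {0..1} (\<lambda>t. coeff B i * (t ^ (s + M) * (1 - t) powr (\<mu> + real i)))" for i
    using assms by (intro set_integrable_mult_right set_integrable_power_times_powr) auto
  \<comment> \<open>No bound \<open>k\<close> is at hand for the integrability claim;
    \<open>Suc (degree A)\<close> always serves as one.\<close>
  have "set_integrable lborel {0..1} (\<lambda>t. \<Sum>i<Suc (degree A). coeff B i * (t ^ (s + M) * (1 - t) powr (\<mu> + real i)))"
    using int unfolding set_integrable_def by (simp only: scaleR_sum_right Bochner_Integration.integrable_sum)
  then show "set_integrable lborel {0..1} (\<lambda>t. poly A t * t ^ s * (t ^ M * (1 - t) powr \<mu>))"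
    by (rule iffD1[OF set_integrable_cong, rotated 3]) (use eq[of "Suc (degree A)"] in auto)
  assume k: "A = 0 \<or> degree A < k"
  have "(LBINT t:{0..1}. poly A t * t ^ s * (t ^ M * (1 - t) powr \<mu>))
      = (LBINT t:{0..1}. \<Sum>i<k. coeff B i * (t ^ (s + M) * (1 - t) powr (\<mu> + real i)))"
    using eq[OF k] by (intro set_lebesgue_integral_cong) auto
  also have "\<dots> = (\<Sum>i<k. LBINT t:{0..1}. coeff B i * (t ^ (s + M) * (1 - t) powr (\<mu> + real i)))"
    using int unfolding set_lebesgue_integral_def set_integrable_def
    by (simp only: scaleR_sum_right Bochner_Integration.integral_sum)
  also have "\<dots> = (\<Sum>i<k. coeff B i * JP_moment M s (\<mu> + real i))"
    using assms by (intro sum.cong refl)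
      (subst set_integral_mult_right, subst set_integral_power_times_powr, auto simp: JP_moment_def)
  finally show "(LBINT t:{0..1}. poly A t * t ^ s * (t ^ M * (1 - t) powr \<mu>))
        = (\<Sum>i<k. coeff (pcompose A [:1, -1:]) i * JP_moment M s (\<mu> + real i))"
    by (simp add: B_def)
qed

lemma pcompose_one_minus_involution: "pcompose (pcompose A [:1, -1:]) [:1, -1::'a::comm_ring_1:] = A"
proof -
  have "pcompose [:1, -1:] [:1, -1::'a:] = [:0, 1:]"
    by (simp add: pcompose_pCons)
  then show ?thesis
    by (metis pcompose_assoc pcompose_idR)
qed

text \<open>The unknowns are the coefficients in powers of \<open>1 - t\<close>, one for each pair
  \<open>(l, i)\<close> with \<open>i < k l\<close>, so there are as many as equations. They solve
  the moment system at the nodes \<open>\<mu> l + real i\<close>.\<close>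

theorem type_I_Jacobi_Pineiro_ex1:
  fixes \<mu> :: "'r::finite \<Rightarrow> real"
  assumes \<mu>: "\<And>i. \<mu> i > -1" and incommensurable: "\<And>i k. i \<noteq> k \<Longrightarrow> \<mu> i - \<mu> k \<notin> \<int>"
  shows "\<exists>!A. is_type_I_Jacobi_Pineiro M \<mu> k A"
proof -
  define I where "I = (SIGMA l:UNIV. {..<k l})"
  define \<alpha> where "\<alpha> = (\<lambda>(l, i). \<mu> l + real i)"
  define w where "w l = weight_const (\<mu> l)" for l
  define N where "N = multi_abs k"
  have fin: "finite I" by (simp add: I_def)
  have card: "card I = N" by (simp add: I_def N_def multi_abs_def)
  have w: "w l \<noteq> 0" for l using \<mu>[of l] by (simp add: w_def weight_const_def)
  have pos: "\<alpha> p > -1" for p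
    using \<mu>[of "fst p"] by (cases p) (simp add: \<alpha>_def)
  have inj: "inj_on \<alpha> I"
  proof (rule inj_onI)
    fix p p' assume eq: "\<alpha> p = \<alpha> p'"
    \<comment> \<open>Coinciding nodes from different families would make a difference of two
      exponents \<mu> an integer; within one family the shift is determined.\<close>
    have "\<mu> (fst p) - \<mu> (fst p') = of_int (int (snd p') - int (snd p))"
      using eq by (simp add: \<alpha>_def case_prod_unfold)
    then have "fst p = fst p'" using incommensurable by (metis Ints_of_int)
    then show "p = p'" using eq by (auto simp: \<alpha>_def case_prod_unfold prod_eq_iff)
  qed
  have is_iff: "is_type_I_Jacobi_Pineiro M \<mu> k A \<longleftrightarrow> (\<forall>l. A l = 0 \<or> degree (A l) < k l) \<and>
      (\<forall>s<N. (\<Sum>p\<in>I. w (fst p) * coeff (pcompose (A (fst p)) [:1, -1:]) (snd p) * JP_moment M s (\<alpha> p))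
         = (if s + 1 = N then 1 else 0))" for A
  proof -
    have "(\<Sum>l\<in>UNIV. weight_const (\<mu> l) * (LBINT t:{0..1}. poly (A l) t * t ^ s * (t ^ M * (1 - t) powr \<mu> l)))
        = (\<Sum>p\<in>I. w (fst p) * coeff (pcompose (A (fst p)) [:1, -1:]) (snd p) * JP_moment M s (\<alpha> p))"
      if "\<forall>l. A l = 0 \<or> degree (A l) < k l" for s
    proof -
      have "(\<Sum>l\<in>UNIV. weight_const (\<mu> l) * (LBINT t:{0..1}. poly (A l) t * t ^ s * (t ^ M * (1 - t) powr \<mu> l)))
          = (\<Sum>l\<in>UNIV. \<Sum>i<k l. w l * coeff (pcompose (A l) [:1, -1:]) i * JP_moment M s (\<mu> l + real i))"
      proof (intro sum.cong refl)
        fix l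
        show "weight_const (\<mu> l) * (LBINT t:{0..1}. poly (A l) t * t ^ s * (t ^ M * (1 - t) powr \<mu> l))
            = (\<Sum>i<k l. w l * coeff (pcompose (A l) [:1, -1:]) i * JP_moment M s (\<mu> l + real i))"
          using set_integral_poly_eq_JP_moments[OF \<mu>[of l], of "A l" "k l"] that
          by (simp add: w_def sum_distrib_left mult.assoc)
      qed
      also have "\<dots> = (\<Sum>p\<in>I. w (fst p) * coeff (pcompose (A (fst p)) [:1, -1:]) (snd p) * JP_moment M s (\<alpha> p))"
        unfolding I_def \<alpha>_def by (subst sum.Sigma) (auto simp: case_prod_unfold)
      finally show ?thesis .
    qed
    then show ?thesis unfolding is_type_I_Jacobi_Pineiro_def N_def by auto
  qed
  show ?thesis
  proof (rule ex_ex1I)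
    obtain c where c: "\<And>s. s < N \<Longrightarrow> (\<Sum>p\<in>I. c p * JP_moment M s (\<alpha> p)) = (if s + 1 = N then 1 else 0)"
      using JP_moment_system_solvable[OF fin inj pos, of M] unfolding card by blast
    \<comment> \<open>The solution \<open>c\<close> prescribes the coefficients in powers of
      \<open>1 - t\<close>, up to the weight constants; substituting \<open>1 - t\<close> gives
      polynomials in \<open>t\<close>.\<close>
    define B where "B l = (\<Sum>i<k l. monom (c (l, i) / w l) i)" for l
    define A where "A l = pcompose (B l) [:1, -1:]" for l
    have coeff: "coeff (B l) i = c (l, i) / w l" if "i < k l" for l i
      using that by (simp add: B_def coeff_sum)
    have deg: "A l = 0 \<or> degree (A l) < k l" for l
    proof (cases "k l = 0")
      case False
      then have "degree (B l) < k l"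
        unfolding B_def by (intro degree_sum_less) (auto intro: le_less_trans[OF degree_monom_le])
      then show ?thesis by (simp add: A_def degree_pcompose)
    qed (simp add: A_def B_def)
    have "(\<Sum>p\<in>I. w (fst p) * coeff (pcompose (A (fst p)) [:1, -1:]) (snd p) * JP_moment M s (\<alpha> p))
        = (\<Sum>p\<in>I. c p * JP_moment M s (\<alpha> p))" for s
      using w by (intro sum.cong refl) (auto simp: A_def pcompose_one_minus_involution I_def coeff)
    then have "is_type_I_Jacobi_Pineiro M \<mu> k A"
      using deg c unfolding is_iff by metis
    then show "\<exists>A. is_type_I_Jacobi_Pineiro M \<mu> k A" by (rule exI[of _ A])
  next
    fix A A' assume A: "is_type_I_Jacobi_Pineiro M \<mu> k A" and A': "is_type_I_Jacobi_Pineiro M \<mu> k A'"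
    define b where "b A p = w (fst p) * coeff (pcompose (A (fst p)) [:1, -1:]) (snd p)"
      for A :: "'r \<Rightarrow> real poly" and p
    have "b A p - b A' p = 0" if "p \<in> I" for p
    proof (rule JP_moment_system_injective[OF fin inj pos, where c = "\<lambda>p. b A p - b A' p" and M = M])
      fix s assume "s < card I"
      then have "(\<Sum>p\<in>I. b A p * JP_moment M s (\<alpha> p)) = (\<Sum>p\<in>I. b A' p * JP_moment M s (\<alpha> p))"
        using A A' unfolding is_iff b_def card by auto
      then show "(\<Sum>p\<in>I. (b A p - b A' p) * JP_moment M s (\<alpha> p)) = 0"
        by (simp add: left_diff_distrib sum_subtractf)
    qed (fact that)
    then have coeff: "coeff (pcompose (A l) [:1, -1:]) i = coeff (pcompose (A' l) [:1, -1:]) i" if "i < k l" for l i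
      using w that by (force simp: b_def I_def)
    have "pcompose (A l) [:1, -1:] = pcompose (A' l) [:1, -1:]" for l
    proof (rule poly_eqI)
      fix i
      \<comment> \<open>From index \<open>k l\<close> on, all coefficients vanish, because composing
        with \<open>1 - t\<close> keeps the degree.\<close>
      have "coeff (pcompose (C l) [:1, -1:]) i = 0"
        if "is_type_I_Jacobi_Pineiro M \<mu> k C" "\<not> i < k l" for C
      proof -
        have "C l = 0 \<or> degree (C l) < k l"
          using that(1) by (auto simp: is_type_I_Jacobi_Pineiro_def)
        then show ?thesis using that(2) coeff_eq_0[of "pcompose (C l) [:1, -1:]" i]
          by (auto simp: degree_pcompose)
      qed
      then show "coeff (pcompose (A l) [:1, -1:]) i = coeff (pcompose (A' l) [:1, -1:]) i"
        using coeff A A' by metis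
    qed
    then show "A = A'" by (metis ext pcompose_one_minus_involution)
  qed
qed

subsection \<open>Integration over the disk\<close>

text \<open>By Fubini the measure is assembled from horizontal slices, and on each of them the shear
  acts as a translation, which preserves length.\<close>

lemma lborel_distr_hshear:
  "distr lborel borel (\<lambda>(x, y). (x + c * y, y)) = (lborel :: (real \<times> real) measure)"
proof (rule measure_eqI)
  fix A assume "A \<in> sets (distr lborel borel (\<lambda>(x, y). (x + c * y, y)) :: (real \<times> real) measure)"
  then have A [measurable]: "A \<in> sets borel" by simp
  have T: "(\<lambda>(x, y). (x + c * y, y)) \<in> borel_measurable (borel :: (real \<times> real) measure)"
    by (intro borel_measurable_continuous_onI) (auto simp: case_prod_unfold intro!: continuous_intros)
  have TA: "(\<lambda>(x, y). (x + c * y, y)) -` A \<in> sets borel"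
    using measurable_sets[OF T A] by simp
  have P: "(\<lambda>x. (x, y)) \<in> borel_measurable (borel :: real measure)" for y :: real
    by (intro borel_measurable_continuous_onI continuous_intros)
  have "emeasure (distr lborel borel (\<lambda>(x, y). (x + c * y, y))) A
      = emeasure (lborel \<Otimes>\<^sub>M lborel) ((\<lambda>(x, y). (x + c * y, y)) -` A)"
    using T by (simp add: emeasure_distr lborel_prod)
  also have "\<dots> = (\<integral>\<^sup>+y. emeasure lborel ((\<lambda>x. (x, y)) -` (\<lambda>(x, y). (x + c * y, y)) -` A) \<partial>lborel)"
    using TA by (intro lborel_pair.emeasure_pair_measure_alt2) (simp only: lborel_prod sets_lborel)
  also have "\<dots> = (\<integral>\<^sup>+y. emeasure (distr lborel borel ((+) (c * y))) ((\<lambda>x. (x, y)) -` A) \<partial>lborel)"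
  proof (intro nn_integral_cong)
    fix y
    have "(\<lambda>x. (x, y)) -` A \<in> sets borel"
      using measurable_sets[OF P A] by simp
    then show "emeasure lborel ((\<lambda>x. (x, y)) -` (\<lambda>(x, y). (x + c * y, y)) -` A)
        = emeasure (distr lborel borel ((+) (c * y))) ((\<lambda>x. (x, y)) -` A)"
      by (subst emeasure_distr) (auto simp: vimage_def add.commute)
  qed
  also have "\<dots> = emeasure (lborel \<Otimes>\<^sub>M lborel) A"
    unfolding lborel_distr_plus using A
    by (intro lborel_pair.emeasure_pair_measure_alt2[symmetric]) (simp only: lborel_prod sets_lborel)
  finally show "emeasure (distr lborel borel (\<lambda>(x, y). (x + c * y, y))) A = emeasure lborel A"
    by (simp add: lborel_prod)
qed simp

lemma lborel_distr_vshear: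
  "distr lborel borel (\<lambda>(x, y). (x, y + c * x)) = (lborel :: (real \<times> real) measure)"
proof (rule measure_eqI)
  fix A assume "A \<in> sets (distr lborel borel (\<lambda>(x, y). (x, y + c * x)) :: (real \<times> real) measure)"
  then have A [measurable]: "A \<in> sets borel" by simp
  have T: "(\<lambda>(x, y). (x, y + c * x)) \<in> borel_measurable (borel :: (real \<times> real) measure)"
    by (intro borel_measurable_continuous_onI) (auto simp: case_prod_unfold intro!: continuous_intros)
  have TA: "(\<lambda>(x, y). (x, y + c * x)) -` A \<in> sets borel"
    using measurable_sets[OF T A] by simp
  have P: "Pair x \<in> borel_measurable (borel :: real measure)" for x :: real
    by (intro borel_measurable_continuous_onI continuous_intros)
  have "emeasure (distr lborel borel (\<lambda>(x, y). (x, y + c * x))) A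
      = emeasure (lborel \<Otimes>\<^sub>M lborel) ((\<lambda>(x, y). (x, y + c * x)) -` A)"
    using T by (simp add: emeasure_distr lborel_prod)
  also have "\<dots> = (\<integral>\<^sup>+x. emeasure lborel (Pair x -` (\<lambda>(x, y). (x, y + c * x)) -` A) \<partial>lborel)"
    using TA by (intro lborel.emeasure_pair_measure_alt) (simp only: lborel_prod sets_lborel)
  also have "\<dots> = (\<integral>\<^sup>+x. emeasure (distr lborel borel ((+) (c * x))) (Pair x -` A) \<partial>lborel)"
  proof (intro nn_integral_cong)
    fix x
    have "Pair x -` A \<in> sets borel"
      using measurable_sets[OF P A] by simp
    then show "emeasure lborel (Pair x -` (\<lambda>(x, y). (x, y + c * x)) -` A)
        = emeasure (distr lborel borel ((+) (c * x))) (Pair x -` A)"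
      by (subst emeasure_distr) (auto simp: vimage_def add.commute)
  qed
  also have "\<dots> = emeasure (lborel \<Otimes>\<^sub>M lborel) A"
    unfolding lborel_distr_plus using A
    by (intro lborel.emeasure_pair_measure_alt[symmetric]) (simp only: lborel_prod sets_lborel)
  finally show "emeasure (distr lborel borel (\<lambda>(x, y). (x, y + c * x))) A = emeasure lborel A"
    by (simp add: lborel_prod)
qed simp

text \<open>A rotation is a product of three shears, which preserve the measure by Fubini.\<close>
lemma lborel_distr_rotation:
  fixes c s :: real
  assumes "c\<^sup>2 + s\<^sup>2 = 1" "s \<noteq> 0"
  shows "distr lborel borel (\<lambda>(x, y). (c * x - s * y, s * x + c * y)) = (lborel :: (real \<times> real) measure)"
proof -
  \<comment> \<open>For \<open>c\<close> and \<open>s\<close> the cosine and sine of an angle, this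
    is minus the tangent of the half angle. The two identities for \<open>k\<close> are what makes
    the composite \<open>h \<circ> (v \<circ> h)\<close> the rotation.\<close>
  define k where "k = (c - 1) / s"
  have k: "k * s = c - 1" "k * (1 + c) = - s"
    using assms by (auto simp: k_def field_simps power2_eq_square)
  define h where "h = (\<lambda>(x :: real, y :: real). (x + k * y, y))"
  define v where "v = (\<lambda>(x :: real, y :: real). (x, y + s * x))"
  have h: "h \<in> borel_measurable borel"
    unfolding h_def
    by (intro borel_measurable_continuous_onI) (auto simp: case_prod_unfold intro!: continuous_intros)
  have v: "v \<in> borel_measurable borel"
    unfolding v_def
    by (intro borel_measurable_continuous_onI) (auto simp: case_prod_unfold intro!: continuous_intros)
  have "h (v (h (x, y))) = (c * x - s * y, s * x + c * y)" for x y
    using k unfolding h_def v_def prod.case prod.inject by algebra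
  then have hvh: "(\<lambda>(x, y). (c * x - s * y, s * x + c * y)) = h \<circ> (v \<circ> h)"
    by auto
  have "distr lborel borel (h \<circ> (v \<circ> h)) = distr (distr (distr lborel borel h) borel v) borel h"
    using h v by (simp add: distr_distr comp_assoc)
  also have "\<dots> = lborel"
    by (simp add: h_def v_def lborel_distr_hshear lborel_distr_vshear)
  finally show ?thesis by (simp add: hvh)
qed

text \<open>The rotation preserves the integral I and also multiplies it by \<open>w\<close>, so I =
  w I. For non-integrable \<open>f\<close> the integral is 0 by convention.\<close>

lemma integral_eq_zero_if_rotation_eigenfunction:
  fixes f :: "real \<times> real \<Rightarrow> complex"
  assumes "f \<in> borel_measurable borel" "c\<^sup>2 + s\<^sup>2 = 1" "s \<noteq> 0" "w \<noteq> 1"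
    and "\<And>x y. f (c * x - s * y, s * x + c * y) = w * f (x, y)"
  shows "(LINT p|lborel. f p) = 0"
proof -
  have T: "(\<lambda>(x, y). (c * x - s * y, s * x + c * y)) \<in> borel_measurable (borel :: (real \<times> real) measure)"
    by (intro borel_measurable_continuous_onI) (auto simp: case_prod_unfold intro!: continuous_intros)
  have "(LINT p|lborel. f p) = (LINT p|distr lborel borel (\<lambda>(x, y). (c * x - s * y, s * x + c * y)). f p)"
    using lborel_distr_rotation assms by simp
  also have "\<dots> = (LINT p|lborel. w * f p)"
    using T assms by (subst integral_distr) (auto simp: case_prod_unfold simp del: integral_mult_right_zero)
  finally show ?thesis using \<open>w \<noteq> 1\<close> by simp
qed

section \<open>The distribution of the squared radius on the disk\<close>

lemma unit_disk_borel: "unit_disk \<in> sets borel"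
proof -
  have "unit_disk = cball (0 :: real \<times> real) 1"
    by (auto simp: unit_disk_def dist_norm norm_prod_def)
  also have "\<dots> \<in> sets borel"
    by (intro borel_closed closed_cball)
  finally show ?thesis .
qed

text \<open>Stands in for polar coordinates: a disk of radius sqrt r has area pi r, so the squared
  radius is uniformly distributed with density pi. Measures that are finite and equal on the
  half-lines \<open>{r<..}\<close> coincide.\<close>

lemma distr_disk_norm_square:
  "distr (restrict_space lborel unit_disk) borel (\<lambda>(x, y). x\<^sup>2 + y\<^sup>2)
    = density lborel (\<lambda>t. ennreal (pi * indicator {0..1} t))"
proof (rule measure_eqI_lessThan)
  have q: "(\<lambda>(x, y). x\<^sup>2 + y\<^sup>2) \<in> borel_measurable (borel :: (real \<times> real) measure)"
    by (intro borel_measurable_continuous_onI) (auto simp: case_prod_unfold intro!: continuous_intros)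
  have D: "{(x, y). x\<^sup>2 + y\<^sup>2 \<le> r} = cball (0 :: real \<times> real) (sqrt r)" if "r \<ge> 0" for r
    using that by (auto simp: dist_norm norm_prod_def real_sqrt_le_iff)
  have area: "emeasure lborel {(x :: real, y :: real). x\<^sup>2 + y\<^sup>2 \<le> r} = ennreal (pi * r)" if "r \<ge> 0" for r
    using that by (simp add: D emeasure_cball eval_unit_ball_vol)
  have meas: "{(x :: real, y :: real). x\<^sup>2 + y\<^sup>2 \<le> r} \<in> sets borel" if "r \<ge> 0" for r
    unfolding D[OF that] by (intro borel_closed closed_cball)
  have lhs: "emeasure (distr (restrict_space lborel unit_disk) borel (\<lambda>(x, y). x\<^sup>2 + y\<^sup>2)) {r<..}
      = emeasure lborel {(x :: real, y :: real). r < x\<^sup>2 + y\<^sup>2 \<and> x\<^sup>2 + y\<^sup>2 \<le> 1}" for r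
  proof -
    have "emeasure (distr (restrict_space lborel unit_disk) borel (\<lambda>(x, y). x\<^sup>2 + y\<^sup>2)) {r<..}
      = emeasure (restrict_space lborel unit_disk)
         ((\<lambda>(x, y). x\<^sup>2 + y\<^sup>2) -` {r<..} \<inter> space (restrict_space lborel unit_disk))"
      using q by (intro emeasure_distr) (auto intro: measurable_restrict_space1)
    also have "\<dots> = emeasure lborel ((\<lambda>(x, y). x\<^sup>2 + y\<^sup>2) -` {r<..} \<inter> unit_disk)"
      using unit_disk_borel by (subst emeasure_restrict_space) (auto simp: space_restrict_space)
    also have "(\<lambda>(x, y). x\<^sup>2 + y\<^sup>2) -` {r<..} \<inter> unit_disk
        = {(x :: real, y :: real). r < x\<^sup>2 + y\<^sup>2 \<and> x\<^sup>2 + y\<^sup>2 \<le> 1}"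
      by (auto simp: unit_disk_def)
    finally show ?thesis .
  qed
  have rhs: "emeasure (density lborel (\<lambda>t. ennreal (pi * indicator {0..1} t))) {r<..}
      = ennreal pi * emeasure lborel ({0..1} \<inter> {r<..})" for r :: real
  proof -
    have m: "(\<lambda>t :: real. ennreal (pi * indicator {0..1} t)) \<in> borel_measurable lborel"
      by simp
    have "emeasure (density lborel (\<lambda>t. ennreal (pi * indicator {0..1} t))) {r<..}
        = (\<integral>\<^sup>+t. ennreal pi * indicator ({0..1} \<inter> {r<..}) t \<partial>lborel)"
      by (subst emeasure_density[OF m]) (auto intro!: nn_integral_cong split: split_indicator)
    then show ?thesis by (simp add: nn_integral_cmult_indicator)
  qed
  show E: "emeasure (distr (restrict_space lborel unit_disk) borel (\<lambda>(x, y). x\<^sup>2 + y\<^sup>2)) {r<..}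
      = emeasure (density lborel (\<lambda>t. ennreal (pi * indicator {0..1} t))) {r<..}" for r
  proof -
    \<comment> \<open>The half-line corresponds to the whole disk, to an annulus of area pi (1 - r),
      or to nothing.\<close>
    consider "r < 0" | "0 \<le> r" "r \<le> 1" | "r > 1" by linarith
    then show ?thesis
    proof cases
      case 1
      then have "{(x :: real, y :: real). r < x\<^sup>2 + y\<^sup>2 \<and> x\<^sup>2 + y\<^sup>2 \<le> 1} = {(x, y). x\<^sup>2 + y\<^sup>2 \<le> 1}"
        by (auto intro: less_le_trans[OF _ sum_power2_ge_zero])
      moreover have "{0..1} \<inter> {r<..} = {0..1}" using 1 by auto
      ultimately show ?thesis using area[of 1] by (simp add: lhs rhs)
    next
      case 2
      then have "{(x :: real, y :: real). r < x\<^sup>2 + y\<^sup>2 \<and> x\<^sup>2 + y\<^sup>2 \<le> 1}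
          = {(x, y). x\<^sup>2 + y\<^sup>2 \<le> 1} - {(x, y). x\<^sup>2 + y\<^sup>2 \<le> r}"
        by auto
      also have "emeasure lborel \<dots> = ennreal (pi * 1) - ennreal (pi * r)"
        using 2 area[of r] area[of 1] meas[of r] meas[of 1] by (subst emeasure_Diff) auto
      also have "\<dots> = ennreal (pi * (1 - r))"
        using 2 by (simp add: ennreal_minus algebra_simps)
      finally have "emeasure lborel {(x :: real, y :: real). r < x\<^sup>2 + y\<^sup>2 \<and> x\<^sup>2 + y\<^sup>2 \<le> 1}
          = ennreal (pi * (1 - r))" .
      moreover have "{0..1} \<inter> {r<..} = {r<..1}" using 2 by auto
      ultimately show ?thesis using 2 by (simp only: lhs rhs) (simp add: ennreal_mult')
    next
      case 3
      then have "{(x :: real, y :: real). r < x\<^sup>2 + y\<^sup>2 \<and> x\<^sup>2 + y\<^sup>2 \<le> 1} = {}" "{0..1} \<inter> {r<..} = {}"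
        by auto
      then show ?thesis by (simp only: lhs rhs) simp
    qed
  qed
  show "emeasure (distr (restrict_space lborel unit_disk) borel (\<lambda>(x, y). x\<^sup>2 + y\<^sup>2)) {r<..} < \<infinity>" for r
  proof -
    have "emeasure lborel ({0..1} \<inter> {r<..}) \<le> emeasure lborel {0..1::real}"
      by (intro emeasure_mono) auto
    then have "emeasure lborel ({0..1} \<inter> {r<..}) < \<infinity>"
      using le_less_trans by fastforce
    then show ?thesis unfolding E rhs by (simp add: ennreal_mult_less_top)
  qed
qed auto

section \<open>Monomials in \<open>z\<close> and \<open>cnj z\<close>\<close>

text \<open>Real and imaginary part are linear combinations of \<open>z\<close> and
  \<open>cnj z\<close>, so the monomial is homogeneous of degree a + b in these two. The induction
  adds one linear factor at a time.\<close>

lemma monomial_as_sum_z_cnj: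
  "\<exists>c :: nat \<Rightarrow> complex. \<forall>z. of_real (Re z ^ a * Im z ^ b) = (\<Sum>p\<le>a+b. c p * z ^ p * cnj z ^ (a + b - p))"
proof -
  have step: "\<exists>c'. \<forall>z. (\<alpha> * z + \<beta> * cnj z) * (\<Sum>p\<le>m. c p * z ^ p * cnj z ^ (m - p))
      = (\<Sum>p\<le>Suc m. c' p * z ^ p * cnj z ^ (Suc m - p))" for \<alpha> \<beta> :: complex and c m
  proof (intro exI allI)
    fix z
    \<comment> \<open>Multiplying by \<open>z\<close> shifts the coefficients up and leaves a 0 at
      the bottom; multiplying by \<open>cnj z\<close> keeps the indices and leaves a 0 at the
      top.\<close>
    let ?c1 = "\<lambda>p. case p of 0 \<Rightarrow> 0 | Suc q \<Rightarrow> c q"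
    have 1: "z * (\<Sum>p\<le>m. c p * z ^ p * cnj z ^ (m - p))
        = (\<Sum>p\<le>Suc m. ?c1 p * z ^ p * cnj z ^ (Suc m - p))"
      by (subst sum.atMost_Suc_shift) (simp add: sum_distrib_left mult_ac)
    have 2: "cnj z * (\<Sum>p\<le>m. c p * z ^ p * cnj z ^ (m - p))
        = (\<Sum>p\<le>Suc m. (if p \<le> m then c p else 0) * z ^ p * cnj z ^ (Suc m - p))"
      by (simp add: sum_distrib_left Suc_diff_le mult_ac)
    show "(\<alpha> * z + \<beta> * cnj z) * (\<Sum>p\<le>m. c p * z ^ p * cnj z ^ (m - p))
      = (\<Sum>p\<le>Suc m. (\<alpha> * ?c1 p + \<beta> * (if p \<le> m then c p else 0)) * z ^ p * cnj z ^ (Suc m - p))"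
      unfolding distrib_right mult.assoc[of \<alpha>] mult.assoc[of \<beta>] 1 2
      by (simp only: sum.distrib sum_distrib_left mult.assoc)
  qed
  have Re: "complex_of_real (Re z) = 1/2 * z + 1/2 * cnj z"
    and Im: "complex_of_real (Im z) = - \<i>/2 * z + \<i>/2 * cnj z" for z
    by (simp_all add: complex_eq_iff)
  show ?thesis
  proof (induction a)
    case 0
    show ?case
    proof (induction b)
      case 0
      show ?case by (rule exI[of _ "\<lambda>_. 1"]) simp
    next
      case (Suc b)
      then obtain c where c: "\<And>z. of_real (Re z ^ 0 * Im z ^ b) = (\<Sum>p\<le>0+b. c p * z ^ p * cnj z ^ (0 + b - p))"
        by auto
      obtain c' where c': "\<And>z. (- \<i>/2 * z + \<i>/2 * cnj z) * (\<Sum>p\<le>b. c p * z ^ p * cnj z ^ (b - p))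
          = (\<Sum>p\<le>Suc b. c' p * z ^ p * cnj z ^ (Suc b - p))"
        using step by blast
      have "of_real (Re z ^ 0 * Im z ^ Suc b) = (\<Sum>p\<le>0 + Suc b. c' p * z ^ p * cnj z ^ (0 + Suc b - p))" for z
        using c[of z] c'[of z] unfolding Im[symmetric] by simp
      then show ?case by blast
    qed
  next
    case (Suc a)
    then obtain c where c: "\<And>z. of_real (Re z ^ a * Im z ^ b) = (\<Sum>p\<le>a+b. c p * z ^ p * cnj z ^ (a + b - p))"
      by auto
    obtain c' where c': "\<And>z. (1/2 * z + 1/2 * cnj z) * (\<Sum>p\<le>a+b. c p * z ^ p * cnj z ^ (a + b - p))
        = (\<Sum>p\<le>Suc (a + b). c' p * z ^ p * cnj z ^ (Suc (a + b) - p))"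
      using step by blast
    have "of_real (Re z ^ Suc a * Im z ^ b) = (\<Sum>p\<le>Suc a + b. c' p * z ^ p * cnj z ^ (Suc a + b - p))" for z
      using c[of z] c'[of z] unfolding Re[symmetric] by (simp add: mult_ac)
    then show ?case by blast
  qed
qed

section \<open>Integrals of radial functions times powers of \<open>z\<close> and
  \<open>cnj z\<close>\<close>

lemma
  fixes f :: "real \<Rightarrow> real"
  assumes f [measurable]: "f \<in> borel_measurable borel"
  shows set_integrable_disk_radial_iff:
      "set_integrable lborel unit_disk (\<lambda>(x, y). f (x\<^sup>2 + y\<^sup>2)) \<longleftrightarrow> set_integrable lborel {0..1} f"
    and set_integral_disk_radial:
      "(LBINT p:unit_disk. f ((fst p)\<^sup>2 + (snd p)\<^sup>2)) = pi * (LBINT t:{0..1}. f t)"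
proof -
  let ?q = "\<lambda>(x :: real, y :: real). x\<^sup>2 + y\<^sup>2"
  have q: "?q \<in> borel_measurable borel"
    by (intro borel_measurable_continuous_onI) (auto simp: case_prod_unfold intro!: continuous_intros)
  then have q': "?q \<in> restrict_space lborel unit_disk \<rightarrow>\<^sub>M borel"
    by (intro measurable_restrict_space1) simp
  have disk: "unit_disk \<inter> space lborel \<in> sets lborel"
    using unit_disk_borel by simp
  have "set_integrable lborel unit_disk (\<lambda>(x, y). f (x\<^sup>2 + y\<^sup>2))
      \<longleftrightarrow> integrable (restrict_space lborel unit_disk) (\<lambda>p. f (?q p))"
    unfolding set_integrable_def by (subst integrable_restrict_space[OF disk]) (simp add: case_prod_unfold)
  also have "\<dots> \<longleftrightarrow> integrable (density lborel (\<lambda>t. ennreal (pi * indicator {0..1} t))) f"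
    unfolding distr_disk_norm_square[symmetric] using q' by (subst integrable_distr_eq) simp_all
  also have "\<dots> \<longleftrightarrow> integrable lborel (\<lambda>t. pi * (indicator {0..1} t *\<^sub>R f t))"
    by (subst integrable_density) (auto simp: mult.assoc)
  also have "\<dots> \<longleftrightarrow> set_integrable lborel {0..1} f"
    unfolding set_integrable_def by simp
  finally show "set_integrable lborel unit_disk (\<lambda>(x, y). f (x\<^sup>2 + y\<^sup>2)) \<longleftrightarrow> set_integrable lborel {0..1} f" .
  have "(LBINT p:unit_disk. f ((fst p)\<^sup>2 + (snd p)\<^sup>2)) = (LINT p|restrict_space lborel unit_disk. f (?q p))"
    unfolding set_lebesgue_integral_def by (subst integral_restrict_space[OF disk]) (simp add: case_prod_unfold)
  also have "\<dots> = (LINT t|density lborel (\<lambda>t. ennreal (pi * indicator {0..1} t)). f t)"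
    unfolding distr_disk_norm_square[symmetric] using q' by (subst integral_distr) simp_all
  also have "\<dots> = (LINT t|lborel. pi * (indicator {0..1} t *\<^sub>R f t))"
    by (subst integral_density) (auto simp: mult.assoc)
  also have "\<dots> = pi * (LBINT t:{0..1}. f t)"
    unfolding set_lebesgue_integral_def by simp
  finally show "(LBINT p:unit_disk. f ((fst p)\<^sup>2 + (snd p)\<^sup>2)) = pi * (LBINT t:{0..1}. f t)" .
qed

text \<open>An eigenfunction of rotations: turning by \<phi> multiplies it by e^(i (m - q) \<phi>).
  The indicator is built in so that invariance of the measure on the whole plane applies
  directly.\<close>

definition radial_term :: "(real \<Rightarrow> real) \<Rightarrow> nat \<Rightarrow> nat \<Rightarrow> real \<times> real \<Rightarrow> complex" where
  "radial_term g m q = (\<lambda>(x, y). of_real (indicator unit_disk (x, y) * g (x\<^sup>2 + y\<^sup>2)) *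
     Complex x y ^ m * cnj (Complex x y) ^ q)"

lemma borel_measurable_radial_term:
  assumes [measurable]: "g \<in> borel_measurable borel"
  shows "radial_term g m q \<in> borel_measurable borel"
proof -
  have q [measurable]: "(\<lambda>p :: real \<times> real. (fst p)\<^sup>2 + (snd p)\<^sup>2) \<in> borel_measurable borel"
    by (intro borel_measurable_continuous_onI continuous_intros)
  have z [measurable]: "(\<lambda>p :: real \<times> real. Complex (fst p) (snd p) ^ m * cnj (Complex (fst p) (snd p)) ^ q)
      \<in> borel_measurable borel"
    by (intro borel_measurable_continuous_onI) (auto simp: Complex_eq intro!: continuous_intros)
  have [measurable]: "unit_disk \<in> sets borel" by (rule unit_disk_borel)
  have "radial_term g m q = (\<lambda>p. of_real (indicator unit_disk p * g ((fst p)\<^sup>2 + (snd p)\<^sup>2)) *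
      (Complex (fst p) (snd p) ^ m * cnj (Complex (fst p) (snd p)) ^ q))"
    by (auto simp: radial_term_def fun_eq_iff)
  also have "\<dots> \<in> borel_measurable borel" by measurable
  finally show ?thesis .
qed

text \<open>On the disk the powers of \<open>z\<close> and \<open>cnj z\<close> have modulus at most
  1, so the radial factor dominates.\<close>

lemma integrable_radial_term:
  assumes g: "g \<in> borel_measurable borel" "set_integrable lborel {0..1} g"
  shows "integrable lborel (radial_term g m q)"
proof (rule Bochner_Integration.integrable_bound)
  show "integrable lborel (\<lambda>p. indicator unit_disk p *\<^sub>R (\<lambda>(x, y). g (x\<^sup>2 + y\<^sup>2)) p)"
    using g(2) set_integrable_disk_radial_iff[OF g(1)] unfolding set_integrable_def by simp
  show "radial_term g m q \<in> borel_measurable lborel"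
    using borel_measurable_radial_term[OF g(1)] by simp
  show "AE p in lborel. norm (radial_term g m q p) \<le> norm (indicator unit_disk p *\<^sub>R (\<lambda>(x, y). g (x\<^sup>2 + y\<^sup>2)) p)"
  proof (rule AE_I2)
    fix p :: "real \<times> real"
    obtain x y where p: "p = (x, y)" by fastforce
    show "norm (radial_term g m q p) \<le> norm (indicator unit_disk p *\<^sub>R (\<lambda>(x, y). g (x\<^sup>2 + y\<^sup>2)) p)"
    proof (cases "p \<in> unit_disk")
      case True
      then have "norm (Complex x y) \<le> 1"
        by (simp add: p unit_disk_def complex_norm)
      then have "norm (Complex x y) ^ m * norm (Complex x y) ^ q \<le> 1"
        by (intro mult_le_one power_le_one) auto
      then have "\<bar>g (x\<^sup>2 + y\<^sup>2)\<bar> * (norm (Complex x y) ^ m * norm (Complex x y) ^ q) \<le> \<bar>g (x\<^sup>2 + y\<^sup>2)\<bar> * 1"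
        by (intro mult_left_mono) auto
      then show ?thesis
        using True by (simp add: radial_term_def p norm_mult norm_power mult.assoc)
    next
      case False
      then show ?thesis by (simp add: radial_term_def p)
    qed
  qed
qed

lemma integral_radial_term_off_diagonal:
  assumes g: "g \<in> borel_measurable borel" and "m \<noteq> q"
  shows "(LINT p|lborel. radial_term g m q p) = 0"
proof -
  define k where "k = real m - real q"
  \<comment> \<open>This angle makes the rotation factor \<open>cis 1\<close>, which is not 1, and
    lies within [-1, 1] without being 0, so its sine is nonzero.\<close>
  define \<phi> where "\<phi> = 1 / k"
  have "\<bar>k\<bar> \<ge> 1" using \<open>m \<noteq> q\<close> by (auto simp: k_def)
  then have \<phi>: "\<phi> \<noteq> 0" "\<bar>\<phi>\<bar> \<le> 1" "k * \<phi> = 1"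
    by (auto simp: \<phi>_def field_simps)
  have sin_pos: "sin t > 0" if "0 < t" "t \<le> 1" for t :: real
    using that pi_gt3 by (intro sin_gt_zero) auto
  have "sin \<phi> \<noteq> 0"
    using sin_pos[of \<phi>] sin_pos[of "- \<phi>"] \<phi> by (cases "\<phi> > 0") auto
  moreover have "cis 1 \<noteq> 1"
    using sin_pos[of 1] by (auto simp: complex_eq_iff)
  moreover have "radial_term g m q (cos \<phi> * x - sin \<phi> * y, sin \<phi> * x + cos \<phi> * y) = cis 1 * radial_term g m q (x, y)"
    for x y
  proof -
    have rot: "Complex (cos \<phi> * x - sin \<phi> * y) (sin \<phi> * x + cos \<phi> * y) = cis \<phi> * Complex x y"
      by (simp add: complex_eq_iff)
    have sq: "(cos \<phi> * x - sin \<phi> * y)\<^sup>2 + (sin \<phi> * x + cos \<phi> * y)\<^sup>2 = x\<^sup>2 + y\<^sup>2"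
      using sin_cos_squared_add[of \<phi>] by algebra
    have "cis \<phi> ^ m * cnj (cis \<phi>) ^ q = cis (real m * \<phi> + real q * (- \<phi>))"
      by (simp add: cis_cnj Complex.DeMoivre cis_mult)
    also have "real m * \<phi> + real q * (- \<phi>) = 1"
      using \<phi>(3) by (simp add: k_def algebra_simps)
    finally have "cis \<phi> ^ m * cnj (cis \<phi>) ^ q = cis 1" .
    then have "(cis \<phi> * Complex x y) ^ m * cnj (cis \<phi> * Complex x y) ^ q
        = cis 1 * (Complex x y ^ m * cnj (Complex x y) ^ q)"
      by (simp add: power_mult_distrib)
    moreover have "(cos \<phi> * x - sin \<phi> * y, sin \<phi> * x + cos \<phi> * y) \<in> unit_disk \<longleftrightarrow> (x, y) \<in> unit_disk"
      by (simp add: unit_disk_def sq)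
    ultimately show ?thesis
      by (simp add: radial_term_def rot sq indicator_def mult.assoc)
  qed
  ultimately show ?thesis
    using borel_measurable_radial_term[OF g] sin_cos_squared_add2[of \<phi>]
    by (intro integral_eq_zero_if_rotation_eigenfunction[of _ "cos \<phi>" "sin \<phi>" "cis 1"]) (auto simp: add.commute)
qed

text \<open>Equal powers of \<open>z\<close> and \<open>cnj z\<close> combine to a power of the
  squared radius, so the integrand is radial.\<close>

lemma integral_radial_term_diagonal:
  assumes g [measurable]: "g \<in> borel_measurable borel"
  shows "(LINT p|lborel. radial_term g q q p) = of_real (pi * (LBINT t:{0..1}. t ^ q * g t))"
proof -
  have "radial_term g q q p = of_real (indicator unit_disk p *\<^sub>R
      (((fst p)\<^sup>2 + (snd p)\<^sup>2) ^ q * g ((fst p)\<^sup>2 + (snd p)\<^sup>2)))" for p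
  proof -
    have "z ^ q * cnj z ^ q = of_real (((Re z)\<^sup>2 + (Im z)\<^sup>2) ^ q)" for z
      by (simp add: complex_mult_cnj flip: power_mult_distrib)
    from this[of "Complex (fst p) (snd p)"] show ?thesis
      by (cases p) (simp add: radial_term_def mult_ac)
  qed
  then have "(LINT p|lborel. radial_term g q q p)
      = of_real (LBINT p:unit_disk. ((fst p)\<^sup>2 + (snd p)\<^sup>2) ^ q * g ((fst p)\<^sup>2 + (snd p)\<^sup>2))"
    by (simp only: set_lebesgue_integral_def integral_complex_of_real)
  also have "\<dots> = of_real (pi * (LBINT t:{0..1}. t ^ q * g t))"
    using set_integral_disk_radial[of "\<lambda>t. t ^ q * g t"] by simp
  finally show ?thesis .
qed

section \<open>Orthogonality on the disk\<close>

text \<open>De Moivre's formula removes the angle: the trigonometric factors times r^M are the real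
  and imaginary parts of (x + i y)^M.\<close>

lemma type_I_disk_eq_harmonic:
  assumes "M = multi_abs n - 2 * multi_abs j"
  shows "type_I_disk \<mu> n j \<nu> l x y = poly (type_I_Jacobi_Pineiro M \<mu> j l) (x\<^sup>2 + y\<^sup>2) *
    (if \<nu> = 1 then Re (Complex x y ^ M) else Im (Complex x y ^ M))"
proof -
  define z where "z = Complex x y"
  have r: "sqrt (x\<^sup>2 + y\<^sup>2) = cmod z" by (simp add: z_def complex_norm)
  have "z ^ M = rcis (cmod z ^ M) (real M * Arg z)"
    by (metis DeMoivre2 rcis_cmod_Arg)
  then have "Re (z ^ M) = cmod z ^ M * cos (real M * Arg z)" "Im (z ^ M) = cmod z ^ M * sin (real M * Arg z)"
    by simp_all
  then show ?thesis
    by (simp add: type_I_disk_def type_I_disk_polar_def Let_def r mult.assoc flip: assms z_def)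
      (simp add: z_def complex_norm)
qed

theorem proposition9:
  fixes \<mu> :: "'r::finite \<Rightarrow> real"
    and n j :: "'r \<Rightarrow> nat"
    and \<nu> a b :: nat
  assumes "\<And>i. \<mu> i > -1"
    and "\<And>i k. i \<noteq> k \<Longrightarrow> \<mu> i - \<mu> k \<notin> \<int>"
    and "real (multi_abs j) \<le> real (multi_abs n) / 2"
    and "\<nu> \<in> {1, 2}"
    and "\<nu> = 2 \<Longrightarrow> real (multi_abs j) < real (multi_abs n) / 2"
  shows "let F = (\<lambda>(x, y). \<Sum>l\<in>UNIV. type_I_disk \<mu> n j \<nu> l x y * x ^ a * y ^ b * disk_weight (\<mu> l) x y)
    in set_integrable lborel unit_disk F \<and>
       (int a + int b < int (multi_abs n) - 2 \<longrightarrow> (LBINT p:unit_disk. F p) = 0) \<and>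
       (odd (int a + int b - int (multi_abs n) + 2 * int (multi_abs j)) \<longrightarrow>
          (LBINT p:unit_disk. F p) = 0)"
proof -
  define M where "M = multi_abs n - 2 * multi_abs j"
  define A where "A = type_I_Jacobi_Pineiro M \<mu> j"
  \<comment> \<open>All summands share the angular factor and the monomial, so the polynomials and
    weights merge into one radial function.\<close>
  define g where "g t = (\<Sum>l\<in>UNIV. poly (A l) t * (weight_const (\<mu> l) * (1 - t) powr \<mu> l))" for t
  define F where
    "F = (\<lambda>(x, y). \<Sum>l\<in>UNIV. type_I_disk \<mu> n j \<nu> l x y * x ^ a * y ^ b * disk_weight (\<mu> l) x y)"
  \<comment> \<open>Both choices are real-linear and commute with the integral, so the two values of
    \<open>\<nu>\<close> are treated at once.\<close>
  define part where "part = (if \<nu> = 1 then Re else Im)"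
  \<comment> \<open>The bound on \<open>j\<close> keeps the subtraction in \<open>M\<close> from
    truncating.\<close>
  have n: "int (multi_abs n) = int M + 2 * int (multi_abs j)"
    using assms(3) by (simp add: M_def of_nat_diff)
  have JP: "is_type_I_Jacobi_Pineiro M \<mu> j A"
    unfolding A_def type_I_Jacobi_Pineiro_def
    by (rule theI'[OF type_I_Jacobi_Pineiro_ex1[OF assms(1,2)]])
  have g_meas: "g \<in> borel_measurable borel"
  proof -
    have [measurable]: "poly (A l) \<in> borel_measurable borel" for l
      by (intro borel_measurable_continuous_onI continuous_intros)
    show ?thesis unfolding g_def by measurable
  qed
  \<comment> \<open>The exponent \<open>m\<close> is kept free: \<open>s = m = 0\<close> gives
    integrability of \<open>g\<close>, while \<open>m = M\<close> gives the moments that define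
    \<open>A\<close>.\<close>
  have moment: "set_integrable lborel {0..1} (\<lambda>t. t ^ (s + m) * g t) \<and>
      (LBINT t:{0..1}. t ^ (s + m) * g t) = (\<Sum>l\<in>UNIV. weight_const (\<mu> l) *
         (LBINT t:{0..1}. poly (A l) t * t ^ s * (t ^ m * (1 - t) powr \<mu> l)))" for s m
  proof -
    have eq: "indicator {0..1} t *\<^sub>R (t ^ (s + m) * g t) = (\<Sum>l\<in>UNIV. weight_const (\<mu> l) *
        (indicator {0..1} t *\<^sub>R (poly (A l) t * t ^ s * (t ^ m * (1 - t) powr \<mu> l))))" for t
      by (simp add: g_def sum_distrib_left power_add mult_ac)
    have "integrable lborel (\<lambda>t. weight_const (\<mu> l) *
        (indicator {0..1} t *\<^sub>R (poly (A l) t * t ^ s * (t ^ m * (1 - t) powr \<mu> l))))" for l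
      using set_integrable_poly_times_powr[OF assms(1)] unfolding set_integrable_def
      by (intro integrable_mult_right) auto
    then show ?thesis
      unfolding set_integrable_def set_lebesgue_integral_def eq
      by (simp only: Bochner_Integration.integrable_sum Bochner_Integration.integral_sum integral_mult_right_zero)
  qed
  have g_int: "set_integrable lborel {0..1} g"
    using moment[of 0 0] by simp
  obtain c where c: "\<And>z. of_real (Re z ^ a * Im z ^ b) = (\<Sum>p\<le>a+b. c p * z ^ p * cnj z ^ (a + b - p))"
    using monomial_as_sum_z_cnj by blast
  \<comment> \<open>The \<open>c p\<close> are complex, so the real or imaginary part is taken only
    of the whole sum.\<close>
  define H where "H v = (\<Sum>p\<le>a+b. c p * radial_term g (M + p) (a + b - p) v)" for v
  have F: "indicator unit_disk v *\<^sub>R F v = part (H v)" for v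
  proof -
    obtain x y where v: "v = (x, y)" by fastforce
    define z where "z = Complex x y"
    have "F v = g (x\<^sup>2 + y\<^sup>2) * (x ^ a * y ^ b) * part (z ^ M)"
      by (auto simp: F_def v type_I_disk_eq_harmonic[OF M_def] g_def A_def part_def disk_weight_def z_def
          sum_distrib_left sum_distrib_right diff_diff_eq mult_ac intro!: sum.cong)
    also have "\<dots> = part (of_real (g (x\<^sup>2 + y\<^sup>2)) * z ^ M * of_real (x ^ a * y ^ b))"
      by (simp add: part_def Re_complex_of_real mult_ac)
    finally have "indicator unit_disk v *\<^sub>R F v
        = part (of_real (indicator unit_disk v * g (x\<^sup>2 + y\<^sup>2)) * z ^ M * of_real (Re z ^ a * Im z ^ b))"
      by (simp add: z_def indicator_def part_def)
    also have "of_real (indicator unit_disk v * g (x\<^sup>2 + y\<^sup>2)) * z ^ M * of_real (Re z ^ a * Im z ^ b) = H v"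
      unfolding c H_def by (simp add: radial_term_def v z_def sum_distrib_left power_add mult_ac)
    finally show ?thesis .
  qed
  have H_int: "integrable lborel H"
    unfolding H_def using integrable_radial_term[OF g_meas g_int] by auto
  \<comment> \<open>The condition on \<open>p\<close> is strict because the moment of index |j| - 1
    is 1, not 0.\<close>
  have H_zero: "(LINT v|lborel. H v) = 0"
    if vanish: "\<And>p. M + p = a + b - p \<Longrightarrow> p \<le> a + b \<Longrightarrow> p + 1 < multi_abs j"
  proof -
    have "(LINT v|lborel. radial_term g (M + p) (a + b - p) v) = 0" if p: "p \<le> a + b" for p
    proof (cases "M + p = a + b - p")
      case True
      then have "p + 1 < multi_abs j" using vanish p by blast
      then have "(LBINT t:{0..1}. t ^ (p + M) * g t) = 0"
        using JP moment[of p M] by (simp add: is_type_I_Jacobi_Pineiro_def)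
      then show ?thesis
        using integral_radial_term_diagonal[OF g_meas, of "p + M"] True by (simp add: add.commute)
    next
      case False
      then show ?thesis by (rule integral_radial_term_off_diagonal[OF g_meas])
    qed
    then show ?thesis
      unfolding H_def using integrable_radial_term[OF g_meas g_int]
      by (subst Bochner_Integration.integral_sum) auto
  qed
  \<comment> \<open>This ensures that the vanishing below is not the default value 0 of a divergent
    integral.\<close>
  have "set_integrable lborel unit_disk F"
    unfolding set_integrable_def F using H_int by (auto simp: part_def)
  moreover have "(LBINT v:unit_disk. F v) = part (LINT v|lborel. H v)"
    unfolding set_lebesgue_integral_def F using H_int by (auto simp: part_def)
  \<comment> \<open>The surviving index satisfies a + b = M + 2 p, and |n| - 2 = M + 2 (|j| -
    1).\<close>
  moreover have "(LINT v|lborel. H v) = 0" if "int a + int b < int (multi_abs n) - 2"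
    using that n by (intro H_zero) linarith
  moreover have "(LINT v|lborel. H v) = 0"
    if "odd (int a + int b - int (multi_abs n) + 2 * int (multi_abs j))"
  proof (rule H_zero)
    \<comment> \<open>A surviving index would make the odd quantity even, so there is none.\<close>
    fix p assume "M + p = a + b - p" "p \<le> a + b"
    then have "int a + int b - int (multi_abs n) + 2 * int (multi_abs j) = 2 * int p"
      using n by linarith
    then show "p + 1 < multi_abs j" using that by simp
  qed
  ultimately show ?thesis
    unfolding Let_def F_def[symmetric] by (auto simp: part_def)
qed

end
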